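(* Let $p$ be a probability density on $\mathbb{R}$ supported on a finite union of intervals (i.e. $\{x: p(x)>0\}$ is a finite union of intervals). Then for any $\epsilon>0$ there exist a flow $f=f_T\circ\cdots\circ f_1$ composed of finitely many ReLU planar flows $f_1,\dots,f_T$ on $\mathbb{R}$ and a (one-dimensional) Gaussian density $q_{\mathcal N}$ such that $\|f\#q_{\mathcal N}-p\|_1\le\epsilon$, where $\|\cdot\|_1$ is the $L^1(\mathbb{R})$ norm.
   Context: A ReLU planar flow on $\mathbb{R}$ is a map $f(z)=z+u\,\mathrm{ReLU}(wz+b)$ with $u\in\{1,-1\}$, $w,b\in\mathbb{R}$ and $uw>-1$ (so that $f$ is strictly increasing and invertible), where $\mathrm{ReLU}(x)=\max(x,0)$. If $z$ is a random variable with density $q$, then $f\#q$ denotes the density of $f(z)$. A Gaussian density on $\mathbb{R}$ is the density of $\mathcal N(\mu,\sigma^2)$ for some $\mu\in\mathbb{R}$, $\sigma>0$. *)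

theory Defs
  imports "HOL-Probability.Probability"
begin

definition relu :: "real \<Rightarrow> real" where
  "relu x = max x 0"

definition relu_planar_flow :: "(real \<Rightarrow> real) \<Rightarrow> bool" where
  "relu_planar_flow f \<longleftrightarrow>
     (\<exists>u w b. u \<in> {1, -1} \<and> u * w > -1 \<and> f = (\<lambda>z. z + u * relu (w * z + b)))"

text \<open>The list holds the maps in order of application:
  \<open>compose_maps [f1, ..., fT]\<close> is \<open>fT \<circ> ... \<circ> f1\<close>.\<close>

definition compose_maps :: "(real \<Rightarrow> real) list \<Rightarrow> real \<Rightarrow> real" where
  "compose_maps fs = fold (\<circ>) fs id"

definition probability_density :: "(real \<Rightarrow> real) \<Rightarrow> bool" where
  "probability_density p \<longleftrightarrow>
     p \<in> borel_measurable borel \<and> (\<forall>x. 0 \<le> p x) \<and> (\<integral>\<^sup>+x. ennreal (p x) \<partial>lborel) = 1"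

definition gaussian_density :: "(real \<Rightarrow> real) \<Rightarrow> bool" where
  "gaussian_density q \<longleftrightarrow> (\<exists>\<mu> \<sigma>. \<sigma> > 0 \<and> q = normal_density \<mu> \<sigma>)"

definition finite_union_of_intervals :: "real set \<Rightarrow> bool" where
  "finite_union_of_intervals S \<longleftrightarrow>
     (\<exists>\<I>. finite \<I> \<and> (\<forall>I\<in>\<I>. is_interval I) \<and> S = \<Union>\<I>)"

text \<open>\<open>g\<close> is a version of \<open>f#q\<close>, the density of \<open>f(z)\<close> for \<open>z\<close> with density \<open>q\<close>.
  It is a relation because a density is determined only almost everywhere. The condition
  \<open>0 \<le> g x\<close> is needed since \<open>ennreal\<close> sends negative numbers to \<open>0\<close>.\<close>

definition pushforward_density ::
  "(real \<Rightarrow> real) \<Rightarrow> (real \<Rightarrow> real) \<Rightarrow> (real \<Rightarrow> real) \<Rightarrow> bool" where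
  "pushforward_density f q g \<longleftrightarrow>
     (\<forall>x. 0 \<le> g x) \<and>
     distributed (density lborel (\<lambda>x. ennreal (q x))) lborel f (\<lambda>x. ennreal (g x))"

definition L1_norm :: "(real \<Rightarrow> real) \<Rightarrow> ennreal" where
  "L1_norm h = (\<integral>\<^sup>+x. ennreal \<bar>h x\<bar> \<partial>lborel)"

end

theory Submission
  imports Defs
begin

text \<open>Finite compositions of ReLU planar flows form a group under composition, and pushing
  forward by an invertible map is an isometry of \<open>L\<^sup>1\<close>. A positive step function \<open>s\<close> is the derivative
  of an increasing piecewise linear map, built from planar flows one kink at a time, and that map
  carries \<open>s(x) dx\<close> to \<open>dx\<close>. Hence every step density that is positive exactly on a bounded
  interval is carried by a flow to the uniform density on \<open>[0,1)\<close>. Step densities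
  are dense in \<open>L\<^sup>1\<close>, so both the Gaussian and \<open>p\<close> lie within \<open>\<epsilon>/2\<close> of such densities; if \<open>f1\<close> and
  \<open>f2\<close> are the corresponding flows, then \<open>f2\<^sup>-\<^sup>1 \<circ> f1\<close> is the required one.\<close>

section \<open>The group of flows: composition, monotonicity, inverses\<close>

text \<open>The empty list is allowed, which makes \<open>id\<close> the base case of inductions on
  flows; the nonempty list of the final statement is recovered at the very end.\<close>

definition flow :: "(real \<Rightarrow> real) \<Rightarrow> bool" where
  "flow f \<longleftrightarrow> (\<exists>fs. (\<forall>f\<in>set fs. relu_planar_flow f) \<and> f = compose_maps fs)"

lemma compose_maps_append: "compose_maps (fs @ gs) = compose_maps gs \<circ> compose_maps fs"
proof -
  \<comment> \<open>\<open>fold\<close> composes on the left, so an arbitrary initial map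
    \<open>h\<close> splits off on the right. Each step changes the accumulator, hence the general
    \<open>h\<close>.\<close>
  have "fold (\<circ>) gs h = fold (\<circ>) gs id \<circ> h" for h :: "real \<Rightarrow> real"
  proof (induction gs arbitrary: h)
    case Nil
    show ?case by (simp add: fun_eq_iff)
  next
    case (Cons g gs)
    have "fold (\<circ>) (g # gs) h = fold (\<circ>) gs (g \<circ> h)" by simp
    also have "\<dots> = fold (\<circ>) gs id \<circ> g \<circ> h" by (subst Cons) (rule comp_assoc[symmetric])
    also have "fold (\<circ>) gs id \<circ> g = fold (\<circ>) gs g" by (rule Cons[symmetric])
    also have "\<dots> = fold (\<circ>) (g # gs) id" by simp
    finally show ?case .
  qed
  then show ?thesis unfolding compose_maps_def fold_append by (metis comp_apply)
qed

lemma compose_maps_Nil: "compose_maps [] = id"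
  by (simp add: compose_maps_def fun_eq_iff)

lemma compose_maps_single: "compose_maps [f] = f"
  by (simp add: compose_maps_def fun_eq_iff)

lemma flow_id: "flow id"
  unfolding flow_def by (rule exI[of _ "[]"]) (simp add: compose_maps_Nil)

lemma flow_single: "relu_planar_flow f \<Longrightarrow> flow f"
  unfolding flow_def by (rule exI[of _ "[f]"]) (simp add: compose_maps_single)

lemma flow_comp: "flow f \<Longrightarrow> flow g \<Longrightarrow> flow (g \<circ> f)"
  unfolding flow_def by (metis compose_maps_append set_append Un_iff)

lemma flow_induct [consumes 1, case_names id comp]:
  assumes "flow f" "P id"
    and "\<And>f g. flow f \<Longrightarrow> P f \<Longrightarrow> relu_planar_flow g \<Longrightarrow> P (g \<circ> f)"
  shows "P f"
proof -
  obtain fs where fs: "\<forall>f\<in>set fs. relu_planar_flow f" "f = compose_maps fs"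
    using assms(1) by (auto simp: flow_def)
  have "P (compose_maps fs)" using fs(1)
  proof (induction fs rule: rev_induct)
    case Nil
    then show ?case using assms(2) by (metis compose_maps_Nil)
  next
    case (snoc g fs)
    then have "flow (compose_maps fs)" by (auto simp: flow_def)
    with snoc have "P (g \<circ> compose_maps fs)" by (intro assms(3)) auto
    then show ?case by (metis compose_maps_append compose_maps_single)
  qed
  with fs(2) show ?thesis by simp
qed

text \<open>A planar flow is continuous and piecewise affine, with slope 1 where the ReLU is
  inactive and \<open>1 + u * w\<close> where it is active; both are positive.\<close>

lemma relu_planar_flow_strict_mono:
  assumes "relu_planar_flow f"
  shows "strict_mono f"
proof
  fix x y :: real assume xy: "x < y"
  from assms obtain u w b where u: "u \<in> {1, -1}" "u * w > -1"
    and f: "f = (\<lambda>z. z + u * relu (w * z + b))"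
    by (auto simp: relu_planar_flow_def)
  have *: "(y - x) * (1 + u * w) > 0"
    using xy u(2) by (intro mult_pos_pos) auto
  have 1: "w \<ge> 0 \<Longrightarrow> w * x \<le> w * y" "w \<le> 0 \<Longrightarrow> w * y \<le> w * x"
    using xy by (auto intro: mult_left_mono mult_left_mono_neg)
  show "f x < f y"
    using u(1) * 1 xy unfolding f relu_def
    by (cases "w \<ge> 0") (auto simp: max_def algebra_simps)
qed

lemma relu_planar_flow_continuous:
  assumes "relu_planar_flow f"
  shows "continuous_on UNIV f"
  using assms by (auto simp: relu_planar_flow_def relu_def intro!: continuous_intros)

text \<open>On the active half-line \<open>f\<close> multiplies \<open>w * x + b\<close> by the
  slope \<open>d = 1 + u * w\<close>; elsewhere it is the identity. As \<open>d > 0\<close>, both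
  half-lines are preserved, and the inverse subtracts \<open>u\<close> times the ReLU of the new
  value divided by \<open>d\<close>: again a planar flow, with opposite \<open>u\<close>, with
  \<open>w\<close> and \<open>b\<close> divided by \<open>d\<close>, and with active slope
  \<open>1 / d\<close>.\<close>

lemma relu_planar_flow_inverse:
  assumes "relu_planar_flow f"
  obtains g where "relu_planar_flow g" "\<And>x. g (f x) = x" "\<And>y. f (g y) = y"
proof -
  from assms obtain u w b where u: "u \<in> {1, -1}" "u * w > -1"
    and f: "f = (\<lambda>z. z + u * relu (w * z + b))"
    by (auto simp: relu_planar_flow_def)
  define d where "d = 1 + u * w"
  have d: "d > 0" using u by (simp add: d_def)
  define g where "g = (\<lambda>z. z + (-u) * relu ((w / d) * z + b / d))"
  have relu_div: "relu ((w / d) * z + b / d) = relu (w * z + b) / d" for z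
    using d by (auto simp: relu_def max_def field_simps zero_le_mult_iff not_le)
  have pos: "relu (d * t) = d * relu t" for t
    using d by (auto simp: relu_def max_def zero_le_mult_iff not_le mult_le_0_iff)
  have neg: "relu (t / d) = relu t / d" for t
    using d by (auto simp: relu_def max_def zero_le_divide_iff not_le divide_le_0_iff)
  have "relu_planar_flow g"
    unfolding relu_planar_flow_def
  proof (intro exI conjI)
    show "g = (\<lambda>z. z + (-u) * relu ((w / d) * z + b / d))" by (rule g_def)
    show "-u \<in> {1, -1}" using u by auto
    show "-1 < -u * (w / d)" using d by (simp add: field_simps) (simp add: d_def)
  qed
  moreover have "g (f x) = x" for x
  proof -
    have "relu (w * f x + b) = d * relu (w * x + b)"
    proof (cases "w * x + b > 0")
      case True
      then have "w * f x + b = d * (w * x + b)"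
        by (simp add: f relu_def d_def algebra_simps)
      then show ?thesis by (simp add: pos)
    qed (simp add: f relu_def)
    then have "g (f x) = f x - u * relu (w * x + b)" using d by (simp only: g_def relu_div) simp
    then show ?thesis by (simp add: f)
  qed
  moreover have "f (g y) = y" for y
  proof -
    have "relu (w * g y + b) = relu (w * y + b) / d"
    proof (cases "w * y + b > 0")
      case True
      then have "w * g y + b = (w * y + b) / d"
        using d by (simp only: g_def relu_div)
          (simp add: relu_def d_def field_simps)
      then show ?thesis by (simp add: neg)
    next
      case False
      then have "relu (w * y + b) = 0" by (simp add: relu_def)
      moreover from this have "g y = y" by (simp only: g_def relu_div)
      ultimately show ?thesis by simp
    qed
    then have "f (g y) = g y + u * (relu (w * y + b) / d)" by (simp only: f)
    then show ?thesis by (simp only: g_def relu_div)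
  qed
  ultimately show ?thesis by (rule that)
qed

lemma flow_strict_mono: "flow f \<Longrightarrow> strict_mono f"
  by (induction rule: flow_induct)
    (auto simp: strict_mono_def dest!: relu_planar_flow_strict_mono)

lemma flow_continuous: "flow f \<Longrightarrow> continuous_on UNIV f"
proof (induction rule: flow_induct)
  case (comp f g)
  then show ?case
    by (intro continuous_on_compose) (auto intro: continuous_on_subset relu_planar_flow_continuous)
qed (simp add: id_def)

lemma flow_measurable: "flow f \<Longrightarrow> f \<in> borel_measurable borel"
  by (intro borel_measurable_continuous_onI flow_continuous)

lemma flow_inverse:
  assumes "flow f"
  obtains g where "flow g" "\<And>x. g (f x) = x" "\<And>y. f (g y) = y"
proof -
  have "\<exists>g. flow g \<and> (\<forall>x. g (f x) = x) \<and> (\<forall>y. f (g y) = y)"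
    using assms
  proof (induction rule: flow_induct)
    case id
    show ?case using flow_id by auto
  next
    case (comp f g)
    then obtain f' where f': "flow f'" "\<forall>x. f' (f x) = x" "\<forall>y. f (f' y) = y" by auto
    obtain g' where g': "relu_planar_flow g'" "\<And>x. g' (g x) = x" "\<And>y. g (g' y) = y"
      using relu_planar_flow_inverse[OF comp(2)] by blast
    show ?case
    proof (intro exI conjI)
      show "flow (f' \<circ> g')" by (intro flow_comp flow_single f'(1) g'(1))
    qed (simp_all add: f' g')
  qed
  then show ?thesis using that by auto
qed

section \<open>Elementary flows: translations and single kinks\<close>

lemma translation_flow: "flow (\<lambda>z. z + t)"
proof (rule flow_single, unfold relu_planar_flow_def, intro exI conjI)
  \<comment> \<open>With \<open>w = 0\<close> the ReLU is the constant \<open>\<bar>t\<bar>\<close>.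
    The factor in front must be 1 or -1, never 0; adding 1/2 to \<open>sgn t\<close> before taking
    the sign assigns 1 to \<open>t = 0\<close>.\<close>
  show "(\<lambda>z. z + t) = (\<lambda>z. z + sgn (sgn t + 1/2) * relu (0 * z + \<bar>t\<bar>))"
    by (auto simp: relu_def sgn_if)
qed (auto simp: sgn_if)

lemma kink_flow:
  fixes c \<rho> :: real
  assumes "\<rho> > 0"
  shows "flow (\<lambda>z. if z < c then z else c + \<rho> * (z - c))"
proof (rule flow_single, unfold relu_planar_flow_def, intro exI conjI)
  \<comment> \<open>Chosen so that \<open>?u * ?w = \<rho> - 1\<close>, which makes the active slope
    \<open>\<rho>\<close>; with \<open>?w \<ge> 0\<close> the ReLU acts only to the right of
    \<open>c\<close>.\<close>
  let ?u = "if \<rho> \<ge> 1 then 1 else -1 :: real" and ?w = "\<bar>\<rho> - 1\<bar>"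
  have *: "relu (?w * z + - ?w * c) = ?w * relu (z - c)" for z
  proof -
    have "?w * z + - ?w * c = ?w * (z - c)" by (simp add: algebra_simps)
    then show ?thesis by (auto simp: relu_def max_def zero_le_mult_iff mult_le_0_iff)
  qed
  show "(\<lambda>z. if z < c then z else c + \<rho> * (z - c)) = (\<lambda>z. z + ?u * relu (?w * z + - ?w * c))"
    unfolding * by (auto simp: relu_def max_def algebra_simps)
qed (use assms in auto)

section \<open>Transport of weighted Lebesgue measure\<close>

text \<open>\<open>f\<close> pushes the measure \<open>s(x) dx\<close> forward to \<open>r(x) dx\<close>.\<close>

definition transports :: "(real \<Rightarrow> real) \<Rightarrow> (real \<Rightarrow> real) \<Rightarrow> (real \<Rightarrow> real) \<Rightarrow> bool" where
  "transports f s r \<longleftrightarrow> (\<forall>k\<in>borel_measurable borel.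
     (\<integral>\<^sup>+x. k (f x) * ennreal (s x) \<partial>lborel) = (\<integral>\<^sup>+x. k x * ennreal (r x) \<partial>lborel))"

lemma transportsD:
  "transports f s r \<Longrightarrow> k \<in> borel_measurable borel \<Longrightarrow>
     (\<integral>\<^sup>+x. k (f x) * ennreal (s x) \<partial>lborel) = (\<integral>\<^sup>+x. k x * ennreal (r x) \<partial>lborel)"
  by (simp add: transports_def)

lemma transports_comp:
  assumes "transports f s r" "transports g r t" "g \<in> borel_measurable borel"
  shows "transports (g \<circ> f) s t"
  unfolding transports_def
proof
  fix k :: "real \<Rightarrow> ennreal" assume k: "k \<in> borel_measurable borel"
  then have "(\<lambda>x. k (g x)) \<in> borel_measurable borel" using assms(3) by simp
  from transportsD[OF assms(1) this] transportsD[OF assms(2) k]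
  show "(\<integral>\<^sup>+x. k ((g \<circ> f) x) * ennreal (s x) \<partial>lborel) = (\<integral>\<^sup>+x. k x * ennreal (t x) \<partial>lborel)"
    by simp
qed

lemma transports_inverse:
  assumes "transports f s r" "g \<in> borel_measurable borel" "\<And>x. g (f x) = x"
  shows "transports g r s"
  unfolding transports_def
proof
  fix k :: "real \<Rightarrow> ennreal" assume k: "k \<in> borel_measurable borel"
  then have "(\<lambda>x. k (g x)) \<in> borel_measurable borel" using assms(2) by simp
  from transportsD[OF assms(1) this] assms(3)
  show "(\<integral>\<^sup>+x. k (g x) * ennreal (r x) \<partial>lborel) = (\<integral>\<^sup>+x. k x * ennreal (s x) \<partial>lborel)"
    by simp
qed

lemma transports_translation: "transports (\<lambda>x. x + t) (\<lambda>_. 1) (\<lambda>_. 1)"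
  unfolding transports_def
proof
  fix k :: "real \<Rightarrow> ennreal" assume "k \<in> borel_measurable borel"
  from nn_integral_real_affine[OF this, of 1 t]
  show "(\<integral>\<^sup>+x. k (x + t) * ennreal 1 \<partial>lborel) = (\<integral>\<^sup>+x. k x * ennreal 1 \<partial>lborel)"
    by (simp add: add.commute)
qed

text \<open>The weight is the derivative of the kink map, so this is the change of variables
  formula, applied separately on the half-lines left and right of \<open>c\<close>.\<close>

lemma transports_kink:
  fixes c \<rho> :: real
  assumes "\<rho> > 0"
  shows "transports (\<lambda>z. if z < c then z else c + \<rho> * (z - c)) (\<lambda>z. if z < c then 1 else \<rho>) (\<lambda>_. 1)"
  unfolding transports_def
proof
  fix k :: "real \<Rightarrow> ennreal" assume k [measurable]: "k \<in> borel_measurable borel"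
  let ?\<phi> = "\<lambda>z. if z < c then z else c + \<rho> * (z - c)"
  \<comment> \<open>The right half, indicator included, is written as a function of the affine image
    \<open>c - \<rho> * c + \<rho> * x\<close>, with \<open>\<rho>\<close> in front, so that the
    affine substitution rule for the whole line applies.\<close>
  have "(\<integral>\<^sup>+x. k (?\<phi> x) * ennreal (if x < c then 1 else \<rho>) \<partial>lborel) =
      (\<integral>\<^sup>+x. k x * indicator {..<c} x + ennreal \<rho> * (k (c - \<rho> * c + \<rho> * x) * indicator {c..} (c - \<rho> * c + \<rho> * x)) \<partial>lborel)"
  proof (intro nn_integral_cong)
    fix x :: real
    have "c \<le> c - \<rho> * c + \<rho> * x \<longleftrightarrow> c \<le> x" using assms by simp
    then show "k (?\<phi> x) * ennreal (if x < c then 1 else \<rho>) =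
      k x * indicator {..<c} x + ennreal \<rho> * (k (c - \<rho> * c + \<rho> * x) * indicator {c..} (c - \<rho> * c + \<rho> * x))"
      by (auto simp: indicator_def algebra_simps)
  qed
  also have "\<dots> = (\<integral>\<^sup>+x. k x * indicator {..<c} x \<partial>lborel) +
      ennreal \<rho> * (\<integral>\<^sup>+x. k (c - \<rho> * c + \<rho> * x) * indicator {c..} (c - \<rho> * c + \<rho> * x) \<partial>lborel)"
    by (simp add: nn_integral_add nn_integral_cmult)
  also have "\<dots> = (\<integral>\<^sup>+x. k x * indicator {..<c} x \<partial>lborel) + (\<integral>\<^sup>+x. k x * indicator {c..} x \<partial>lborel)"
    using nn_integral_real_affine[of "\<lambda>x. k x * indicator {c..} x" \<rho> "c - \<rho> * c"] assms by simp
  also have "\<dots> = (\<integral>\<^sup>+x. k x * indicator {..<c} x + k x * indicator {c..} x \<partial>lborel)"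
    by (simp add: nn_integral_add)
  also have "\<dots> = (\<integral>\<^sup>+x. k x * ennreal 1 \<partial>lborel)"
    by (intro nn_integral_cong) (auto simp: indicator_def)
  finally show "(\<integral>\<^sup>+x. k (?\<phi> x) * ennreal (if x < c then 1 else \<rho>) \<partial>lborel) = (\<integral>\<^sup>+x. k x * ennreal 1 \<partial>lborel)" .
qed

section \<open>Step weights and the flows that flatten them\<close>

text \<open>Half-open intervals make the steps right-continuous, so that the values at the breakpoints
  \<open>B\<close> are determined and no null sets have to be discarded.\<close>

definition step_on :: "real set \<Rightarrow> (real \<Rightarrow> real) \<Rightarrow> bool" where
  "step_on B s \<longleftrightarrow> (\<forall>x y. x \<le> y \<longrightarrow> {x<..y} \<inter> B = {} \<longrightarrow> s x = s y)"

lemma step_onD: "step_on B s \<Longrightarrow> x \<le> y \<Longrightarrow> {x<..y} \<inter> B = {} \<Longrightarrow> s x = s y"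
  by (simp add: step_on_def)

text \<open>Induction on the breakpoints from left to right. Without the jump at the largest one,
  \<open>b\<close>, the weight is flattened by some flow \<open>f\<close>; what remains after
  \<open>f\<close> is a weight with a single jump at \<open>f b\<close>, and a kink there removes
  it. The weight must be 1 left of all breakpoints because the kinks used act only to the right of
  their breakpoint.\<close>

lemma transports_step:
  assumes "finite B" "step_on B s" "\<And>x. s x > 0" "\<And>x. \<forall>b\<in>B. x < b \<Longrightarrow> s x = 1"
    and "s \<in> borel_measurable borel"
  shows "\<exists>f. flow f \<and> transports f s (\<lambda>_. 1)"
  using assms
proof (induction B arbitrary: s rule: finite_linorder_max_induct)
  case empty
  then have "s = (\<lambda>_. 1)" by auto
  then show ?case using flow_id by (auto simp: transports_def)
next
  case (insert b A)
  \<comment> \<open>\<open>m\<close> separates the earlier breakpoints from \<open>b\<close>, so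
    \<open>s m\<close> is the value of \<open>s\<close> just before its jump at
    \<open>b\<close>.\<close>
  have "\<exists>m<b. \<forall>a\<in>A. a < m"
  proof (cases "A = {}")
    case True
    then show ?thesis by (auto intro: exI[of _ "b - 1"])
  next
    case False
    with insert(1,2) obtain m where "Max A < m" "m < b" by (metis Max_in dense)
    then show ?thesis using insert(1) False by (intro exI[of _ m]) auto
  qed
  then obtain m where m: "m < b" "\<And>a. a \<in> A \<Longrightarrow> a < m" by blast
  \<comment> \<open>\<open>s1\<close> continues that value beyond \<open>b\<close>, which leaves
    only breakpoints in \<open>A\<close>.\<close>
  define s1 where "s1 = (\<lambda>x. if x < b then s x else s m)"
  have left: "s x = s m" if "x < b" "\<forall>a\<in>A. a \<le> x" for x
  proof (cases "x \<le> m")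
    case True
    then show ?thesis using m that by (intro step_onD[OF insert(4)]) force+
  next
    case False
    then show ?thesis using m that by (intro step_onD[OF insert(4), symmetric]) force+
  qed
  have "\<exists>f. flow f \<and> transports f s1 (\<lambda>_. 1)"
  proof (rule insert.IH)
    show "step_on A s1"
      unfolding step_on_def
    proof (intro allI impI)
      fix x y :: real assume xy: "x \<le> y" "{x<..y} \<inter> A = {}"
      show "s1 x = s1 y"
      proof (cases "y < b")
        case True
        then have "s x = s y" using xy by (intro step_onD[OF insert(4)]) auto
        with True xy show ?thesis by (simp add: s1_def)
      next
        case False
        show ?thesis
        proof (cases "x < b")
          case True
          have "a \<le> x" if "a \<in> A" for a
            using xy(2) insert(2) False that by (cases "a \<le> x") (auto simp: disjoint_iff)
          with True left False show ?thesis by (simp add: s1_def)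
        next
          case xb: False
          with False show ?thesis by (simp add: s1_def)
        qed
      qed
    qed
    show "s1 x > 0" for x using insert(5) by (simp add: s1_def)
    show "s1 x = 1" if x: "\<forall>a\<in>A. x < a" for x
    proof (cases "x < b")
      case True
      with x insert(6)[of x] show ?thesis by (simp add: s1_def)
    next
      case False
      \<comment> \<open>A point at or beyond \<open>b\<close> lies left of all of \<open>A\<close>
        only if \<open>A\<close> is empty; then \<open>m\<close> is itself left of every breakpoint
        and \<open>s m = 1\<close>.\<close>
      with x insert(2) have "A = {}" by force
      with False m insert(6)[of m] show ?thesis by (simp add: s1_def)
    qed
    show "s1 \<in> borel_measurable borel"
      using insert(7) unfolding s1_def by measurable
  qed
  then obtain f where f: "flow f" "transports f s1 (\<lambda>_. 1)" by blast
  \<comment> \<open>The factor by which \<open>s\<close> jumps at \<open>b\<close>. As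
    \<open>f\<close> is strictly increasing, the jump of \<open>k\<close> at \<open>f b\<close>
    pulls back to \<open>b\<close>, which gives \<open>s x = k (f x) * s1 x\<close>.\<close>
  define \<rho> where "\<rho> = s b / s m"
  define k where "k = (\<lambda>y. if y < f b then 1 else \<rho>)"
  define \<phi> where "\<phi> = (\<lambda>z. if z < f b then z else f b + \<rho> * (z - f b))"
  have \<rho>: "\<rho> > 0" using insert(5) by (simp add: \<rho>_def)
  have right: "s x = s b" if "b \<le> x" for x
    using that insert(2) by (intro step_onD[OF insert(4), symmetric]) force+
  have s_eq: "s x = k (f x) * s1 x" for x
    using right[of x] insert(5)[of m] flow_strict_mono[OF f(1)]
    by (auto simp: k_def s1_def \<rho>_def strict_mono_less)
  have [measurable]: "k \<in> borel_measurable borel" unfolding k_def by measurable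
  have k0: "k y \<ge> 0" for y using \<rho> by (simp add: k_def)
  have "transports f s k"
    unfolding transports_def
  proof
    fix h :: "real \<Rightarrow> ennreal" assume [measurable]: "h \<in> borel_measurable borel"
    have "(\<lambda>x. h x * ennreal (k x)) \<in> borel_measurable borel" by measurable
    from transportsD[OF f(2) this]
    show "(\<integral>\<^sup>+x. h (f x) * ennreal (s x) \<partial>lborel) = (\<integral>\<^sup>+x. h x * ennreal (k x) \<partial>lborel)"
      using k0 by (simp add: s_eq ennreal_mult' mult.assoc)
  qed
  moreover have "transports \<phi> k (\<lambda>_. 1)"
    unfolding \<phi>_def k_def using \<rho> by (rule transports_kink)
  moreover have "flow \<phi>" unfolding \<phi>_def using \<rho> by (rule kink_flow)
  ultimately show ?case using f(1) flow_comp flow_measurable transports_comp by blast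
qed

section \<open>Density of step functions in L1\<close>

text \<open>Each point of \<open>K\<close> has an interval inside \<open>U\<close>; finitely many of
  them cover \<open>K\<close>, and \<open>V\<close> is their union. The open intervals serve the
  covering argument, the half-open ones make the indicator of \<open>V\<close>
  right-continuous.\<close>

lemma compact_open_step:
  fixes K U :: "real set"
  assumes "compact K" "open U" "K \<subseteq> U"
  obtains V B N where "finite B" "step_on B (indicator V)" "V \<in> sets borel"
    "V \<subseteq> {-N..<N}" "K \<subseteq> V" "V \<subseteq> U"
proof -
  have "\<exists>d>0. {x - d..<x + d} \<subseteq> U" if "x \<in> K" for x
  proof -
    have "x \<in> U" using assms(3) that by auto
    then obtain d where d: "d > 0" "cball x d \<subseteq> U"
      using open_contains_cball_eq[OF assms(2)] by auto
    have "{x - d..<x + d} \<subseteq> cball x d" unfolding cball_eq_atLeastAtMost by auto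
    with d show ?thesis by (intro exI[of _ d]) auto
  qed
  then obtain d where d: "\<And>x. x \<in> K \<Longrightarrow> d x > 0" "\<And>x. x \<in> K \<Longrightarrow> {x - d x..<x + d x} \<subseteq> U"
    by metis
  have "K \<subseteq> (\<Union>x\<in>K. {x - d x<..<x + d x})" using d(1) by force
  from compactE_image[OF assms(1) _ this]
  obtain C where C: "C \<subseteq> K" "finite C" "K \<subseteq> (\<Union>x\<in>C. {x - d x<..<x + d x})" by auto
  define V where "V = (\<Union>x\<in>C. {x - d x..<x + d x})"
  have "bounded V" unfolding V_def using C(2) by (intro bounded_UN) auto
  then obtain M where M: "\<And>x. x \<in> V \<Longrightarrow> \<bar>x\<bar> \<le> M" by (auto simp: bounded_iff)
  show ?thesis
  proof (rule that)
    show "finite ((\<lambda>x. x - d x) ` C \<union> (\<lambda>x. x + d x) ` C)" using C by simp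
    show "step_on ((\<lambda>x. x - d x) ` C \<union> (\<lambda>x. x + d x) ` C) (indicator V)"
      unfolding step_on_def
    proof (intro allI impI)
      fix x y :: real
      assume xy: "x \<le> y" "{x<..y} \<inter> ((\<lambda>x. x - d x) ` C \<union> (\<lambda>x. x + d x) ` C) = {}"
      have "x \<in> {c - d c..<c + d c} \<longleftrightarrow> y \<in> {c - d c..<c + d c}" if "c \<in> C" for c
      proof -
        have "c - d c \<notin> {x<..y}" "c + d c \<notin> {x<..y}" using xy(2) that by blast+
        with xy(1) show ?thesis by auto
      qed
      then show "indicator V x = (indicator V y :: real)"
        by (auto simp: V_def indicator_def)
    qed
    show "V \<in> sets borel" unfolding V_def using C(2) by auto
    \<comment> \<open>The bound \<open>M\<close> may be attained while the window is open on the
      right, hence the extra 1.\<close>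
    show "V \<subseteq> {-(M + 1)..<M + 1}" using M by (force simp: abs_le_iff)
    show "K \<subseteq> V" using C(3) unfolding V_def by force
    show "V \<subseteq> U" using d(2) C(1) unfolding V_def by blast
  qed
qed

text \<open>Inner regularity gives a compact \<open>K\<close> inside \<open>A\<close>, outer
  regularity an open \<open>U\<close> around \<open>K\<close>, each at a cost of at most
  \<open>e / 2\<close>. For \<open>V\<close> between \<open>K\<close> and \<open>U\<close>, the
  symmetric difference with \<open>A\<close> lies in
  \<open>(A - K) \<union> (U - K)\<close>.\<close>

lemma finite_measure_step_approx:
  fixes A :: "real set"
  assumes A [measurable]: "A \<in> sets borel" and fin: "emeasure lborel A < \<infinity>" and e: "e > 0"
  obtains V B N where "finite B" "step_on B (indicator V)" "V \<in> sets borel"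
    "V \<subseteq> {-N..<N}" "emeasure lborel ((A - V) \<union> (V - A)) \<le> ennreal e"
proof -
  \<comment> \<open>Restricting Lebesgue measure to \<open>A\<close> makes it finite, as inner
    regularity asks.\<close>
  let ?M = "density lborel (indicator A)"
  have em: "emeasure ?M X = emeasure lborel (A \<inter> X)" if "X \<in> sets borel" for X
    using that by (simp add: emeasure_density indicator_inter_arith[symmetric])
  have fin': "emeasure ?M A \<noteq> \<infinity>" using fin by (simp add: em)
  have "emeasure ?M A = (SUP K \<in> {K. K \<subseteq> A \<and> compact K}. emeasure ?M K)"
    using fin by (intro inner_regular) (auto simp: em)
  moreover have "{K. K \<subseteq> A \<and> compact K} \<noteq> {}" by auto
  ultimately obtain K where K: "K \<subseteq> A" "compact K" "emeasure ?M A < emeasure ?M K + ennreal (e / 2)"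
    using SUP_approx_ennreal[of "e / 2" "{K. K \<subseteq> A \<and> compact K}" "emeasure ?M A" "emeasure ?M"] e fin'
    by auto
  have K_borel [measurable]: "K \<in> sets borel" using K(2) by (simp add: borel_compact)
  have finK: "emeasure lborel K < \<infinity>"
    using emeasure_mono[OF K(1), of lborel] fin by (simp add: order_le_less_trans)
  have "emeasure lborel A \<le> emeasure lborel K + ennreal (e / 2)"
    using K by (simp add: em Int_absorb1)
  then have AK: "emeasure lborel (A - K) \<le> ennreal (e / 2)"
    using finK K(1) by (subst emeasure_Diff) (auto simp: ennreal_minus_le_iff add.commute)
  obtain U where U: "open U" "K \<subseteq> U" "emeasure lebesgue (U - K) < ennreal (e / 2)"
    using sets_lebesgue_outer_open[of K "e / 2"] e by auto
  have [measurable]: "U \<in> sets borel" using U(1) by simp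
  obtain V B N where V: "finite B" "step_on B (indicator V)" "V \<in> sets borel"
    "V \<subseteq> {-N..<N}" "K \<subseteq> V" "V \<subseteq> U"
    by (rule compact_open_step[OF K(2) U(1,2)])
  have [measurable]: "V \<in> sets borel" by fact
  have "emeasure lborel ((A - V) \<union> (V - A)) \<le> emeasure lborel ((A - K) \<union> (U - K))"
    using V(5,6) K(1) by (intro emeasure_mono) auto
  also have "\<dots> \<le> emeasure lborel (A - K) + emeasure lborel (U - K)"
    by (intro emeasure_subadditive) auto
  also have "\<dots> \<le> ennreal (e / 2) + ennreal (e / 2)"
    using AK U(3) by (intro add_mono) auto
  also have "\<dots> = ennreal e" using e by (simp flip: ennreal_plus)
  finally show ?thesis by (rule that[OF V(1-4)])
qed

text \<open>Induction on integrable functions: indicators come from the approximation of sets, sums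
  merge breakpoints and windows, and limits follow from dominated convergence.\<close>

lemma integrable_step_approx:
  fixes f :: "real \<Rightarrow> real"
  assumes "integrable lborel f" "e > 0"
  shows "\<exists>t B N. finite B \<and> step_on B t \<and> t \<in> borel_measurable borel \<and>
    (\<forall>x. x \<notin> {-N..<N} \<longrightarrow> t x = 0) \<and> (\<integral>\<^sup>+x. ennreal \<bar>f x - t x\<bar> \<partial>lborel) \<le> ennreal e"
  using assms
proof (induction arbitrary: e rule: integrable_induct)
  case (base A c)
  define d where "d = e / (\<bar>c\<bar> + 1)"
  have d: "d > 0" using base by (simp add: d_def)
  have A [measurable]: "A \<in> sets borel" using base by simp
  obtain V B N where V: "finite B" "step_on B (indicator V)" "V \<in> sets borel"
    "V \<subseteq> {-N..<N}" "emeasure lborel ((A - V) \<union> (V - A)) \<le> ennreal d"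
    by (rule finite_measure_step_approx[OF A base(2) d])
  have [measurable]: "V \<in> sets borel" by fact
  let ?t = "\<lambda>x. indicator V x * c"
  have "(\<integral>\<^sup>+x. ennreal \<bar>indicator A x *\<^sub>R c - ?t x\<bar> \<partial>lborel) =
      (\<integral>\<^sup>+x. ennreal \<bar>c\<bar> * indicator ((A - V) \<union> (V - A)) x \<partial>lborel)"
    by (intro nn_integral_cong) (auto simp: indicator_def)
  also have "\<dots> = ennreal \<bar>c\<bar> * emeasure lborel ((A - V) \<union> (V - A))"
    by (simp add: nn_integral_cmult)
  also have "\<dots> \<le> ennreal \<bar>c\<bar> * ennreal d" using V(5) by (intro mult_left_mono) auto
  also have "\<dots> = ennreal (\<bar>c\<bar> * d)" using d by (simp add: ennreal_mult)
  also have "\<dots> \<le> ennreal e" using base(3) by (intro ennreal_leI) (simp add: d_def field_simps)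
  finally have "(\<integral>\<^sup>+x. ennreal \<bar>indicator A x *\<^sub>R c - ?t x\<bar> \<partial>lborel) \<le> ennreal e" .
  moreover have "step_on B ?t" using V(2) unfolding step_on_def by metis
  moreover have "\<forall>x. x \<notin> {-N..<N} \<longrightarrow> ?t x = 0" using V(4) by (auto simp: indicator_def)
  moreover have "?t \<in> borel_measurable borel" by measurable
  ultimately show ?case using V(1) by blast
next
  case (add f g)
  have [measurable]: "f \<in> borel_measurable borel" "g \<in> borel_measurable borel"
    using add by auto
  from add.IH(1)[of "e / 2"] add.prems obtain t B N where t: "finite B" "step_on B t"
    "t \<in> borel_measurable borel" "\<forall>x. x \<notin> {-N..<N} \<longrightarrow> t x = 0"
    "(\<integral>\<^sup>+x. ennreal \<bar>f x - t x\<bar> \<partial>lborel) \<le> ennreal (e / 2)" by auto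
  from add.IH(2)[of "e / 2"] add.prems obtain t' B' N' where t': "finite B'" "step_on B' t'"
    "t' \<in> borel_measurable borel" "\<forall>x. x \<notin> {-N'..<N'} \<longrightarrow> t' x = 0"
    "(\<integral>\<^sup>+x. ennreal \<bar>g x - t' x\<bar> \<partial>lborel) \<le> ennreal (e / 2)" by auto
  have [measurable]: "t \<in> borel_measurable borel" "t' \<in> borel_measurable borel" by fact+
  have "(\<integral>\<^sup>+x. ennreal \<bar>f x + g x - (t x + t' x)\<bar> \<partial>lborel)
      \<le> (\<integral>\<^sup>+x. ennreal \<bar>f x - t x\<bar> + ennreal \<bar>g x - t' x\<bar> \<partial>lborel)"
    by (intro nn_integral_mono) (auto simp flip: ennreal_plus intro!: ennreal_leI)
  also have "\<dots> = (\<integral>\<^sup>+x. ennreal \<bar>f x - t x\<bar> \<partial>lborel) + (\<integral>\<^sup>+x. ennreal \<bar>g x - t' x\<bar> \<partial>lborel)"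
    by (simp add: nn_integral_add)
  also have "\<dots> \<le> ennreal (e / 2) + ennreal (e / 2)" using t(5) t'(5) by (intro add_mono)
  also have "\<dots> = ennreal e" using add.prems by (simp flip: ennreal_plus)
  finally have "(\<integral>\<^sup>+x. ennreal \<bar>f x + g x - (t x + t' x)\<bar> \<partial>lborel) \<le> ennreal e" .
  moreover have "step_on (B \<union> B') (\<lambda>x. t x + t' x)"
    using t(2) t'(2) unfolding step_on_def by (metis Int_Un_distrib Un_empty)
  moreover have "\<forall>x. x \<notin> {- max N N'..<max N N'} \<longrightarrow> t x + t' x = 0"
    using t(4) t'(4) by (metis add_0 atLeastLessThan_iff le_max_iff_disj less_max_iff_disj minus_le_iff max_def)
  moreover have "(\<lambda>x. t x + t' x) \<in> borel_measurable borel" by measurable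
  ultimately show ?case using t(1) t'(1) by blast
next
  case (lim f s)
  have [measurable]: "f \<in> borel_measurable borel" "\<And>i. s i \<in> borel_measurable borel"
    using lim by auto
  have "(\<lambda>i. (\<integral>\<^sup>+x. norm (f x - s i x) \<partial>lborel)) \<longlonglongrightarrow> 0"
  \<comment> \<open>The induction rule bounds the approximants \<open>s i\<close> pointwise by
    \<open>2 * norm (f x)\<close>, which serves as the dominating function.\<close>
  proof (rule nn_integral_dominated_convergence_norm[where w = "\<lambda>x. 2 * norm (f x)"])
    show "(\<integral>\<^sup>+x. ennreal (2 * norm (f x)) \<partial>lborel) < \<infinity>"
      using lim.hyps(4) by (simp add: integrable_iff_bounded ennreal_mult nn_integral_cmult ennreal_mult_less_top)
  qed (use lim in auto)
  then have "\<forall>\<^sub>F i in sequentially. (\<integral>\<^sup>+x. norm (f x - s i x) \<partial>lborel) < ennreal (e / 2)"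
    using lim.prems by (intro order_tendstoD(2)) auto
  then obtain i where i: "(\<integral>\<^sup>+x. norm (f x - s i x) \<partial>lborel) < ennreal (e / 2)"
    by (auto simp: eventually_sequentially)
  from lim.IH[of "e / 2" i] lim.prems obtain t B N where t: "finite B" "step_on B t"
    "t \<in> borel_measurable borel" "\<forall>x. x \<notin> {-N..<N} \<longrightarrow> t x = 0"
    "(\<integral>\<^sup>+x. ennreal \<bar>s i x - t x\<bar> \<partial>lborel) \<le> ennreal (e / 2)" by auto
  have [measurable]: "t \<in> borel_measurable borel" by fact
  have "(\<integral>\<^sup>+x. ennreal \<bar>f x - t x\<bar> \<partial>lborel)
      \<le> (\<integral>\<^sup>+x. ennreal \<bar>f x - s i x\<bar> + ennreal \<bar>s i x - t x\<bar> \<partial>lborel)"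
    by (intro nn_integral_mono) (auto simp flip: ennreal_plus intro!: ennreal_leI)
  also have "\<dots> = (\<integral>\<^sup>+x. ennreal \<bar>f x - s i x\<bar> \<partial>lborel) + (\<integral>\<^sup>+x. ennreal \<bar>s i x - t x\<bar> \<partial>lborel)"
    by (simp add: nn_integral_add)
  also have "\<dots> \<le> ennreal (e / 2) + ennreal (e / 2)" using t(5) i by (intro add_mono) auto
  also have "\<dots> = ennreal e" using lim.prems by (simp flip: ennreal_plus)
  finally show ?case using t by blast
qed

section \<open>Approximating a probability density\<close>

text \<open>A step approximant \<open>t\<close> in L1 is repaired in three ways: its negative part
  is cut off, a small constant \<open>\<delta>\<close> makes it positive on a window, and it is
  divided by its mass \<open>c\<close>. The error is \<open>e / 4\<close> for \<open>t\<close>,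
  \<open>e / 4\<close> for \<open>\<delta>\<close> and \<open>e / 2\<close> for the
  normalisation.\<close>

lemma density_step_approx:
  assumes "probability_density p" "e > 0"
  obtains s B a b where "finite B" "step_on B s" "\<And>x. s x > 0"
    "\<And>x. \<forall>b\<in>B. x < b \<Longrightarrow> s x = 1" "s \<in> borel_measurable borel" "a < b"
    "(\<integral>\<^sup>+x. indicator {a..<b} x * ennreal (s x) \<partial>lborel) = 1"
    "(\<integral>\<^sup>+x. ennreal \<bar>p x - s x * indicator {a..<b} x\<bar> \<partial>lborel) \<le> ennreal e"
proof -
  have p [measurable]: "p \<in> borel_measurable borel" and p0: "\<And>x. p x \<ge> 0"
    and p1: "(\<integral>\<^sup>+x. ennreal (p x) \<partial>lborel) = 1"
    using assms(1) by (auto simp: probability_density_def)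
  have "integrable lborel p"
    using p0 p1 by (auto simp: integrable_iff_bounded)
  from integrable_step_approx[OF this, of "e / 4"] assms(2)
  obtain t B N0 where t: "finite B" "step_on B t" "t \<in> borel_measurable borel"
    "\<And>x. x \<notin> {-N0..<N0} \<Longrightarrow> t x = 0"
    "(\<integral>\<^sup>+x. ennreal \<bar>p x - t x\<bar> \<partial>lborel) \<le> ennreal (e / 4)" by auto
  have [measurable]: "t \<in> borel_measurable borel" by fact
  define N where "N = max N0 1"
  have N: "N \<ge> 1" by (simp add: N_def)
  have tN: "t x = 0" if "x \<notin> {-N..<N}" for x using that by (intro t(4)) (auto simp: N_def)
  \<comment> \<open>The window has length \<open>2 * N\<close>, so \<open>\<delta>\<close>
    contributes mass exactly \<open>e / 4\<close>.\<close>
  define \<delta> where "\<delta> = e / (8 * N)"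
  have \<delta>: "\<delta> > 0" using assms(2) N by (simp add: \<delta>_def)
  define r where "r = (\<lambda>x. (max (t x) 0 + \<delta>) * indicator {-N..<N} x)"
  have [measurable]: "r \<in> borel_measurable borel" unfolding r_def by measurable
  have r0: "r x \<ge> 0" for x using \<delta> by (simp add: r_def)
  have \<delta>N: "(\<integral>\<^sup>+x. ennreal \<delta> * indicator {-N..<N} x \<partial>lborel) = ennreal (e / 4)"
    using N \<delta> by (simp add: nn_integral_cmult flip: ennreal_mult) (simp add: \<delta>_def)
  have "(\<integral>\<^sup>+x. ennreal \<bar>p x - r x\<bar> \<partial>lborel)
      \<le> (\<integral>\<^sup>+x. ennreal \<bar>p x - t x\<bar> + ennreal \<delta> * indicator {-N..<N} x \<partial>lborel)"
  proof (intro nn_integral_mono)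
    fix x
    have "\<bar>p x - r x\<bar> \<le> \<bar>p x - t x\<bar> + \<delta> * indicator {-N..<N} x"
      using p0[of x] \<delta> tN[of x] by (cases "x \<in> {-N..<N}") (auto simp: r_def)
    then have "ennreal \<bar>p x - r x\<bar> \<le> ennreal (\<bar>p x - t x\<bar> + \<delta> * indicator {-N..<N} x)"
      by (rule ennreal_leI)
    also have "\<dots> = ennreal \<bar>p x - t x\<bar> + ennreal \<delta> * indicator {-N..<N} x"
      using \<delta> by (auto simp: indicator_def)
    finally show "ennreal \<bar>p x - r x\<bar> \<le> ennreal \<bar>p x - t x\<bar> + ennreal \<delta> * indicator {-N..<N} x" .
  qed
  also have "\<dots> = (\<integral>\<^sup>+x. ennreal \<bar>p x - t x\<bar> \<partial>lborel) + ennreal (e / 4)"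
    by (subst nn_integral_add) (simp_all only: \<delta>N, measurable)
  also have "\<dots> \<le> ennreal (e / 4) + ennreal (e / 4)" using t(5) by (intro add_mono) auto
  also have "\<dots> = ennreal (e / 2)" using assms(2) by (simp flip: ennreal_plus)
  finally have pr: "(\<integral>\<^sup>+x. ennreal \<bar>p x - r x\<bar> \<partial>lborel) \<le> ennreal (e / 2)" .
  have "(\<integral>\<^sup>+x. ennreal (r x) \<partial>lborel) \<le> (\<integral>\<^sup>+x. ennreal (p x) + ennreal \<bar>p x - r x\<bar> \<partial>lborel)"
    using p0 by (intro nn_integral_mono) (auto simp flip: ennreal_plus intro!: ennreal_leI)
  also have "\<dots> \<le> 1 + ennreal (e / 2)" using pr by (simp add: nn_integral_add p1)
  finally have r_le: "(\<integral>\<^sup>+x. ennreal (r x) \<partial>lborel) \<le> 1 + ennreal (e / 2)" .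
  have "1 = (\<integral>\<^sup>+x. ennreal (p x) \<partial>lborel)" by (simp add: p1)
  also have "\<dots> \<le> (\<integral>\<^sup>+x. ennreal (r x) + ennreal \<bar>p x - r x\<bar> \<partial>lborel)"
    using r0 by (intro nn_integral_mono) (auto simp flip: ennreal_plus intro!: ennreal_leI)
  also have "\<dots> \<le> (\<integral>\<^sup>+x. ennreal (r x) \<partial>lborel) + ennreal (e / 2)"
    using pr by (simp add: nn_integral_add)
  finally have r_ge: "1 \<le> (\<integral>\<^sup>+x. ennreal (r x) \<partial>lborel) + ennreal (e / 2)" .
  \<comment> \<open>For large \<open>e\<close> the bound \<open>r_ge\<close> does not exclude mass
    0; the mass of the added constant does.\<close>
  have "(\<integral>\<^sup>+x. ennreal \<delta> * indicator {-N..<N} x \<partial>lborel) \<le> (\<integral>\<^sup>+x. ennreal (r x) \<partial>lborel)"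
    by (intro nn_integral_mono) (auto simp: r_def indicator_def intro!: ennreal_leI)
  then have r_pos: "ennreal (e / 4) \<le> (\<integral>\<^sup>+x. ennreal (r x) \<partial>lborel)" by (simp only: \<delta>N)
  obtain c where c0: "c \<ge> 0" and c: "(\<integral>\<^sup>+x. ennreal (r x) \<partial>lborel) = ennreal c"
    using r_le by (cases "\<integral>\<^sup>+x. ennreal (r x) \<partial>lborel") (auto simp: top_unique)
  have "c > 0" using r_pos assms(2) unfolding c by (simp add: ennreal_le_iff2)
  have "c \<le> 1 + e / 2"
    using r_le assms(2) unfolding c by (simp flip: ennreal_1 ennreal_plus)
  moreover have "1 \<le> c + e / 2"
    using r_ge assms(2) c0 unfolding c by (simp flip: ennreal_1 ennreal_plus)
  ultimately have c1: "\<bar>c - 1\<bar> \<le> e / 2" by linarith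
  \<comment> \<open>Outside the window \<open>s\<close> is 1, not 0: to be flattened by a flow it
    must be positive everywhere and equal to 1 left of all breakpoints. The density is
    \<open>s\<close> times the indicator of the window.\<close>
  define s where "s = (\<lambda>x. if x \<in> {-N..<N} then (max (t x) 0 + \<delta>) / c else 1)"
  have s_r: "s x * indicator {-N..<N} x = r x / c" for x
    by (simp add: s_def r_def indicator_def)
  have s_pos: "s x > 0" for x using \<open>c > 0\<close> \<delta> by (simp add: s_def add_nonneg_pos)
  show ?thesis
  proof (rule that)
    show "finite (insert (-N) (insert N B))" using t(1) by simp
    show "step_on (insert (-N) (insert N B)) s"
      unfolding step_on_def
    proof (intro allI impI)
      fix x y assume xy: "x \<le> y" "{x<..y} \<inter> insert (-N) (insert N B) = {}"
      then have "t x = t y" by (intro step_onD[OF t(2)]) auto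
      moreover have "-N \<notin> {x<..y}" "N \<notin> {x<..y}" using xy(2) by blast+
      with xy(1) have "x \<in> {-N..<N} \<longleftrightarrow> y \<in> {-N..<N}" by auto
      ultimately show "s x = s y" by (simp add: s_def)
    qed
    show "s x > 0" for x by (rule s_pos)
    show "s x = 1" if "\<forall>b\<in>insert (-N) (insert N B). x < b" for x
      using that by (auto simp: s_def)
    show "s \<in> borel_measurable borel" unfolding s_def by measurable
    show "-N < N" using N by simp
    have "(\<integral>\<^sup>+x. indicator {-N..<N} x * ennreal (s x) \<partial>lborel) = (\<integral>\<^sup>+x. ennreal (1 / c) * ennreal (r x) \<partial>lborel)"
    proof (intro nn_integral_cong)
      fix x
      have "indicator {-N..<N} x * ennreal (s x) = ennreal (s x * indicator {-N..<N} x)"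
        by (auto simp: indicator_def)
      then show "indicator {-N..<N} x * ennreal (s x) = ennreal (1 / c) * ennreal (r x)"
        using \<open>c > 0\<close> r0 unfolding s_r by (simp flip: ennreal_mult)
    qed
    also have "\<dots> = ennreal (1 / c) * ennreal c" by (simp add: nn_integral_cmult c)
    also have "\<dots> = 1" using \<open>c > 0\<close> by (simp flip: ennreal_mult)
    finally show "(\<integral>\<^sup>+x. indicator {-N..<N} x * ennreal (s x) \<partial>lborel) = 1" .
    have "(\<integral>\<^sup>+x. ennreal \<bar>p x - s x * indicator {-N..<N} x\<bar> \<partial>lborel)
        \<le> (\<integral>\<^sup>+x. ennreal \<bar>p x - r x\<bar> + ennreal \<bar>1 - 1 / c\<bar> * ennreal (r x) \<partial>lborel)"
    proof (intro nn_integral_mono)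
      fix x
      have "\<bar>1 - 1 / c\<bar> * r x = \<bar>(1 - 1 / c) * r x\<bar>" using r0[of x] by (simp add: abs_mult)
      also have "(1 - 1 / c) * r x = r x - r x / c" by (simp add: algebra_simps)
      finally have "\<bar>p x - r x / c\<bar> \<le> \<bar>p x - r x\<bar> + \<bar>1 - 1 / c\<bar> * r x" by simp
      then show "ennreal \<bar>p x - s x * indicator {-N..<N} x\<bar>
          \<le> ennreal \<bar>p x - r x\<bar> + ennreal \<bar>1 - 1 / c\<bar> * ennreal (r x)"
        using r0[of x] unfolding s_r by (simp flip: ennreal_mult ennreal_plus)
    qed
    also have "\<dots> = (\<integral>\<^sup>+x. ennreal \<bar>p x - r x\<bar> \<partial>lborel) + ennreal \<bar>1 - 1 / c\<bar> * ennreal c"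
      by (simp add: nn_integral_add nn_integral_cmult c)
    \<comment> \<open>This is the L1 distance between \<open>r\<close> and \<open>r / c\<close>, as
      \<open>r\<close> has mass \<open>c\<close>.\<close>
    also have "ennreal \<bar>1 - 1 / c\<bar> * ennreal c = ennreal \<bar>c - 1\<bar>"
      using \<open>c > 0\<close> by (simp add: abs_if field_simps flip: ennreal_mult)
    also have "(\<integral>\<^sup>+x. ennreal \<bar>p x - r x\<bar> \<partial>lborel) + ennreal \<bar>c - 1\<bar> \<le> ennreal (e / 2) + ennreal (e / 2)"
      using pr c1 by (intro add_mono ennreal_leI)
    also have "\<dots> = ennreal e" using assms(2) by (simp flip: ennreal_plus)
    finally show "(\<integral>\<^sup>+x. ennreal \<bar>p x - s x * indicator {-N..<N} x\<bar> \<partial>lborel) \<le> ennreal e" .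
  qed
qed

text \<open>Transport preserves mass, so the interval on which \<open>s\<close> has mass 1 goes to
  an interval of length 1, which a translation moves to \<open>{0..<1}\<close>. This common target
  is what later links two densities.\<close>

lemma density_transport_approx:
  assumes "probability_density p" "e > 0"
  obtains f s where "flow f" "s \<in> borel_measurable borel" "\<And>x. s x > 0"
    "transports f s (\<lambda>_. 1)"
    "(\<integral>\<^sup>+x. ennreal \<bar>p x - s x * indicator {0..<1} (f x)\<bar> \<partial>lborel) \<le> ennreal e"
proof -
  obtain s B a b where s: "finite B" "step_on B s" "\<And>x. s x > 0"
    "\<And>x. \<forall>b\<in>B. x < b \<Longrightarrow> s x = 1" "s \<in> borel_measurable borel" and ab: "a < b"
    and int: "(\<integral>\<^sup>+x. indicator {a..<b} x * ennreal (s x) \<partial>lborel) = 1"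
    and le: "(\<integral>\<^sup>+x. ennreal \<bar>p x - s x * indicator {a..<b} x\<bar> \<partial>lborel) \<le> ennreal e"
    by (rule density_step_approx[OF assms]) blast
  obtain f0 where f0: "flow f0" "transports f0 s (\<lambda>_. 1)"
    using transports_step[OF s] by blast
  define f where "f = (\<lambda>z. z + - f0 a) \<circ> f0"
  have f: "flow f" unfolding f_def by (intro flow_comp translation_flow f0)
  have tr: "transports f s (\<lambda>_. 1)"
    unfolding f_def by (rule transports_comp[OF f0(2) transports_translation]) simp
  have fa: "f a = 0" by (simp add: f_def)
  have ind: "(indicator {0..<f b} (f x) :: 'b :: zero_neq_one) = indicator {a..<b} x" for x
    using strict_mono_less[OF flow_strict_mono[OF f], of x b]
      strict_mono_less_eq[OF flow_strict_mono[OF f], of a x] by (simp add: indicator_def fa)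
  have fb: "f b > 0" using strict_mono_less[OF flow_strict_mono[OF f], of a b] ab by (simp add: fa)
  have "(\<integral>\<^sup>+x. indicator {0..<f b} (f x) * ennreal (s x) \<partial>lborel) =
      (\<integral>\<^sup>+x. indicator {0..<f b} x * ennreal 1 \<partial>lborel)"
    by (rule transportsD[OF tr]) measurable
  then have "1 = ennreal (f b)" using fb by (simp add: ind int)
  then have "f b = 1" using fb by simp
  with ind have "indicator {0..<1} (f x) = (indicator {a..<b} x :: real)" for x by metis
  with le f s(3,5) tr that show ?thesis by simp
qed

section \<open>From the Gaussian to the target density\<close>

theorem theorem3p2:
  fixes p :: "real \<Rightarrow> real" and \<epsilon> :: real
  assumes "probability_density p"
    and "finite_union_of_intervals {x. p x > 0}"
    and "\<epsilon> > 0"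
  shows "\<exists>fs q g. fs \<noteq> [] \<and> (\<forall>f\<in>set fs. relu_planar_flow f) \<and> gaussian_density q \<and>
           pushforward_density (compose_maps fs) q g \<and>
           L1_norm (\<lambda>x. g x - p x) \<le> ennreal \<epsilon>"
proof -
  define q where "q = normal_density 0 1"
  have q [measurable]: "q \<in> borel_measurable borel" and q0: "\<And>x. q x \<ge> 0"
    by (simp_all add: q_def)
  have "probability_density q"
    using q0 integral_normal_density[of 1 0] integrable_normal_density[of 1 0]
    by (simp add: probability_density_def q_def nn_integral_eq_integral)
  with assms(3) obtain f1 s where f1: "flow f1" and s [measurable]: "s \<in> borel_measurable borel"
    and s0: "\<And>x. s x > 0" and tr1: "transports f1 s (\<lambda>_. 1)"
    and le1: "(\<integral>\<^sup>+x. ennreal \<bar>q x - s x * indicator {0..<1} (f1 x)\<bar> \<partial>lborel) \<le> ennreal (\<epsilon> / 2)"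
    using density_transport_approx[of q "\<epsilon> / 2"] by auto
  from assms(1,3) obtain f2 r where f2: "flow f2" and r [measurable]: "r \<in> borel_measurable borel"
    and r0: "\<And>x. r x > 0" and tr2: "transports f2 r (\<lambda>_. 1)"
    and le2: "(\<integral>\<^sup>+x. ennreal \<bar>p x - r x * indicator {0..<1} (f2 x)\<bar> \<partial>lborel) \<le> ennreal (\<epsilon> / 2)"
    using density_transport_approx[of p "\<epsilon> / 2"] by auto
  obtain h where h: "flow h" "\<And>x. h (f2 x) = x" "\<And>y. f2 (h y) = y"
    using flow_inverse[OF f2] by blast
  \<comment> \<open>\<open>f1\<close> carries \<open>s\<close> to the constant weight, and
    \<open>h\<close>, the inverse of \<open>f2\<close>, carries that on to \<open>r\<close>.\<close>
  define F where "F = h \<circ> f1"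
  have F: "flow F" unfolding F_def by (intro flow_comp f1 h)
  have trF: "transports F s r"
    unfolding F_def using tr1 transports_inverse[OF tr2 flow_measurable[OF h(1)] h(2)] flow_measurable[OF h(1)]
    by (rule transports_comp)
  obtain G where G: "flow G" "\<And>x. G (F x) = x" "\<And>y. F (G y) = y"
    using flow_inverse[OF F] by blast
  have [measurable]: "F \<in> borel_measurable borel" "G \<in> borel_measurable borel"
    "f1 \<in> borel_measurable borel" "f2 \<in> borel_measurable borel"
    using F G f1 f2 by (auto intro: flow_measurable)
  \<comment> \<open>Writing \<open>q\<close> as \<open>(q / s) * s\<close> and moving the factor
    \<open>s\<close> by \<open>F\<close> gives the density without differentiating \<open>F\<close>:
    \<open>r x / s (G x)\<close> stands in for the derivative of the inverse map.\<close>
  define g where "g = (\<lambda>x. q (G x) / s (G x) * r x)"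
  have [measurable]: "g \<in> borel_measurable borel" unfolding g_def by measurable
  have p [measurable]: "p \<in> borel_measurable borel"
    using assms(1) by (simp add: probability_density_def)
  have push: "pushforward_density F q g"
    unfolding pushforward_density_def distributed_def
  proof (intro conjI allI)
    show "0 \<le> g x" for x
      using q0[of "G x"] s0[of "G x"] r0[of x] by (simp add: g_def)
    show "distr (density lborel (\<lambda>x. ennreal (q x))) lborel F = density lborel (\<lambda>x. ennreal (g x))"
    proof (rule measure_eqI)
      fix A assume "A \<in> sets (distr (density lborel (\<lambda>x. ennreal (q x))) lborel F)"
      then have A [measurable]: "A \<in> sets borel" by simp
      have "emeasure (distr (density lborel (\<lambda>x. ennreal (q x))) lborel F) A =
          (\<integral>\<^sup>+x. indicator A (F x) * ennreal (q x) \<partial>lborel)"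
        by (subst nn_integral_indicator[symmetric], simp, subst nn_integral_distr)
          (simp_all add: nn_integral_density mult.commute)
      also have "\<dots> = (\<integral>\<^sup>+x. (\<lambda>y. indicator A y * ennreal (q (G y) / s (G y))) (F x) * ennreal (s x) \<partial>lborel)"
      proof (intro nn_integral_cong)
        fix x
        have "ennreal (q x) = ennreal (q x / s x) * ennreal (s x)"
          using s0[of x] q0[of x] by (simp flip: ennreal_mult)
        then show "indicator A (F x) * ennreal (q x) =
            (\<lambda>y. indicator A y * ennreal (q (G y) / s (G y))) (F x) * ennreal (s x)"
          by (simp add: G(2) mult.assoc)
      qed
      also have "\<dots> = (\<integral>\<^sup>+x. (\<lambda>y. indicator A y * ennreal (q (G y) / s (G y))) x * ennreal (r x) \<partial>lborel)"
        by (rule transportsD[OF trF]) measurable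
      also have "\<dots> = (\<integral>\<^sup>+x. ennreal (g x) * indicator A x \<partial>lborel)"
      proof (intro nn_integral_cong)
        fix x
        have "ennreal (g x) = ennreal (q (G x) / s (G x)) * ennreal (r x)"
          using s0[of "G x"] q0[of "G x"] r0[of x] unfolding g_def by (intro ennreal_mult) auto
        then show "(\<lambda>y. indicator A y * ennreal (q (G y) / s (G y))) x * ennreal (r x) = ennreal (g x) * indicator A x"
          by (simp add: mult_ac)
      qed
      also have "\<dots> = emeasure (density lborel (\<lambda>x. ennreal (g x))) A"
        by (simp add: emeasure_density)
      finally show "emeasure (distr (density lborel (\<lambda>x. ennreal (q x))) lborel F) A =
        emeasure (density lborel (\<lambda>x. ennreal (g x))) A" .
    qed simp
  qed simp_all
  have f2F: "f2 (F x) = f1 x" for x by (simp add: F_def h)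
  \<comment> \<open>The isometry: pulled back along \<open>F\<close>, the distance from
    \<open>g\<close> to the step density near \<open>p\<close> becomes the distance from
    \<open>q\<close> to its own step density, since \<open>f2 \<circ> F = f1\<close> matches the two
    indicators.\<close>
  have "(\<integral>\<^sup>+x. ennreal \<bar>g x - r x * indicator {0..<1} (f2 x)\<bar> \<partial>lborel) =
      (\<integral>\<^sup>+x. ennreal \<bar>q (G x) / s (G x) - indicator {0..<1} (f2 x)\<bar> * ennreal (r x) \<partial>lborel)"
  proof (intro nn_integral_cong)
    fix x
    have "g x - r x * indicator {0..<1} (f2 x) = (q (G x) / s (G x) - indicator {0..<1} (f2 x)) * r x"
      by (simp add: g_def algebra_simps)
    then have "\<bar>g x - r x * indicator {0..<1} (f2 x)\<bar> = \<bar>q (G x) / s (G x) - indicator {0..<1} (f2 x)\<bar> * r x"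
      using r0[of x] by (simp add: abs_mult)
    then show "ennreal \<bar>g x - r x * indicator {0..<1} (f2 x)\<bar> =
        ennreal \<bar>q (G x) / s (G x) - indicator {0..<1} (f2 x)\<bar> * ennreal (r x)"
      using r0[of x] by (simp add: ennreal_mult)
  qed
  also have "\<dots> = (\<integral>\<^sup>+x. ennreal \<bar>q (G (F x)) / s (G (F x)) - indicator {0..<1} (f2 (F x))\<bar> * ennreal (s x) \<partial>lborel)"
    by (rule transportsD[OF trF, symmetric]) measurable
  also have "\<dots> = (\<integral>\<^sup>+x. ennreal \<bar>q x - s x * indicator {0..<1} (f1 x)\<bar> \<partial>lborel)"
  proof (intro nn_integral_cong)
    fix x
    have "q x - s x * indicator {0..<1} (f1 x) = (q x / s x - indicator {0..<1} (f1 x)) * s x"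
      using s0[of x] by (simp add: field_simps)
    then have "\<bar>q x - s x * indicator {0..<1} (f1 x)\<bar> = \<bar>q x / s x - indicator {0..<1} (f1 x)\<bar> * s x"
      using s0[of x] by (simp add: abs_mult)
    then show "ennreal \<bar>q (G (F x)) / s (G (F x)) - indicator {0..<1} (f2 (F x))\<bar> * ennreal (s x) =
        ennreal \<bar>q x - s x * indicator {0..<1} (f1 x)\<bar>"
      using s0[of x] by (simp add: ennreal_mult G(2) f2F)
  qed
  finally have gr: "(\<integral>\<^sup>+x. ennreal \<bar>g x - r x * indicator {0..<1} (f2 x)\<bar> \<partial>lborel) \<le> ennreal (\<epsilon> / 2)"
    using le1 by simp
  have "L1_norm (\<lambda>x. g x - p x) \<le> (\<integral>\<^sup>+x. ennreal \<bar>g x - r x * indicator {0..<1} (f2 x)\<bar> +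
      ennreal \<bar>p x - r x * indicator {0..<1} (f2 x)\<bar> \<partial>lborel)"
    unfolding L1_norm_def
    by (intro nn_integral_mono) (auto simp flip: ennreal_plus intro!: ennreal_leI)
  also have "\<dots> = (\<integral>\<^sup>+x. ennreal \<bar>g x - r x * indicator {0..<1} (f2 x)\<bar> \<partial>lborel) +
      (\<integral>\<^sup>+x. ennreal \<bar>p x - r x * indicator {0..<1} (f2 x)\<bar> \<partial>lborel)"
    by (intro nn_integral_add) measurable
  also have "\<dots> \<le> ennreal (\<epsilon> / 2) + ennreal (\<epsilon> / 2)" by (intro add_mono gr le2)
  also have "\<dots> = ennreal \<epsilon>" using assms(3) by (simp flip: ennreal_plus)
  finally have L1: "L1_norm (\<lambda>x. g x - p x) \<le> ennreal \<epsilon>" .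
  obtain fs where fs: "\<forall>f\<in>set fs. relu_planar_flow f" "F = compose_maps fs"
    using F by (auto simp: flow_def)
  \<comment> \<open>With \<open>w = b = 0\<close> a planar flow is the identity; appending it makes
    the list nonempty and leaves \<open>F\<close> unchanged.\<close>
  have "relu_planar_flow id"
    unfolding relu_planar_flow_def
    by (intro exI[of _ 1] exI[of _ 0]) (auto simp: relu_def)
  moreover have "compose_maps (fs @ [id]) = F"
    by (simp only: compose_maps_append compose_maps_single fs(2) id_comp)
  moreover have "gaussian_density q"
    unfolding gaussian_density_def q_def by (intro exI[of _ 0] exI[of _ 1]) simp
  ultimately show ?thesis
    using fs(1) push L1 by (intro exI[of _ "fs @ [id]"] exI[of _ q] exI[of _ g]) auto
qed

end
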